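(* $E_{n,d}$ is an open subset of $Div'_{n,d}$.
   Context: $Div_{n,d}$ is the set of effective divisors of degree $d$ in $\mathbb{P}^n$ (homogeneous coordinates $x_0,\dots,x_n$, $n\geq 1$) defined by real homogeneous polynomials, identified via coefficients with $\mathbb{R}\mathbb{P}^{\binom{n+d}{d}-1}$ and given its standard topology. $Div'_{n,d}\subset Div_{n,d}$ is the subset of divisors defined by real homogeneous polynomials of the form $G(x_0,\dots,x_n)=x_0^d+\sum_{i_0+\cdots+i_n=d,\ i_0<d}c_{i_0,\dots,i_n}x_0^{i_0}\cdots x_n^{i_n}$ (equivalently, divisors not containing $[1:0:\cdots:0]$). $E_{n,d}$ is the subset of $Div'_{n,d}$ of all $G$ such that for every $(x_1,\dots,x_n)\in\mathbb{R}^n\setminus\{0\}$, $G(x_0,x_1,\dots,x_n)$ as a polynomial in $x_0$ has $d$ distinct real roots. *)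

theory Defs
  imports "HOL-Analysis.Analysis"
begin

definition exps :: "nat \<Rightarrow> nat \<Rightarrow> (nat \<Rightarrow> nat) set" where
  "exps n d = {i \<in> {..n} \<rightarrow>\<^sub>E UNIV. (\<Sum>k\<le>n. i k) = d}"

text \<open>A form of degree \<open>d\<close> in \<open>x\<^sub>0, \<dots>, x\<^sub>n\<close> is represented by its coefficient family, an
  element of \<open>exps n d \<rightarrow>\<^sub>E UNIV\<close>, i.e. of the space of real vectors indexed by \<open>exps n d\<close>.\<close>

definition form_eval :: "nat \<Rightarrow> nat \<Rightarrow> ((nat \<Rightarrow> nat) \<Rightarrow> real) \<Rightarrow> (nat \<Rightarrow> real) \<Rightarrow> real" where
  "form_eval n d c x = (\<Sum>i\<in>exps n d. c i * (\<Prod>k\<le>n. x k ^ i k))"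

definition nonzero_forms :: "nat \<Rightarrow> nat \<Rightarrow> ((nat \<Rightarrow> nat) \<Rightarrow> real) topology" where
  "nonzero_forms n d =
     subtopology (powertop_real (exps n d)) ((exps n d \<rightarrow>\<^sub>E UNIV) - {\<lambda>i\<in>exps n d. 0})"

text \<open>The divisor of a nonzero form: its class modulo nonzero real scalars, that is, the point of
  real projective space with homogeneous coordinates \<open>c\<close>.\<close>

definition divisor :: "nat \<Rightarrow> nat \<Rightarrow> ((nat \<Rightarrow> nat) \<Rightarrow> real) \<Rightarrow> ((nat \<Rightarrow> nat) \<Rightarrow> real) set" where
  "divisor n d c = {(\<lambda>i\<in>exps n d. r * c i) | r. r \<noteq> 0}"

definition Div :: "nat \<Rightarrow> nat \<Rightarrow> ((nat \<Rightarrow> nat) \<Rightarrow> real) set set" where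
  "Div n d = divisor n d ` topspace (nonzero_forms n d)"

text \<open>The quotient topology of real projective space; see \<open>quotient_map_divisor\<close> below.\<close>

definition Div_topology :: "nat \<Rightarrow> nat \<Rightarrow> ((nat \<Rightarrow> nat) \<Rightarrow> real) set topology" where
  "Div_topology n d = topology (\<lambda>U. U \<subseteq> Div n d \<and>
     openin (nonzero_forms n d) {c \<in> topspace (nonzero_forms n d). divisor n d c \<in> U})"

definition lead_exp :: "nat \<Rightarrow> nat \<Rightarrow> nat \<Rightarrow> nat" where
  "lead_exp n d = (\<lambda>k\<in>{..n}. if k = 0 then d else 0)"

definition monic_forms :: "nat \<Rightarrow> nat \<Rightarrow> ((nat \<Rightarrow> nat) \<Rightarrow> real) set" where
  "monic_forms n d = {c \<in> exps n d \<rightarrow>\<^sub>E UNIV. c (lead_exp n d) = 1}"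

definition Div' :: "nat \<Rightarrow> nat \<Rightarrow> ((nat \<Rightarrow> nat) \<Rightarrow> real) set set" where
  "Div' n d = divisor n d ` monic_forms n d"

text \<open>\<open>G(t, x\<^sub>1, \<dots>, x\<^sub>n)\<close> is monic of degree \<open>d\<close> in \<open>t\<close>, so its set of real roots is finite, and it
  has \<open>d\<close> distinct real roots iff this set has cardinality \<open>d\<close>.\<close>

definition E :: "nat \<Rightarrow> nat \<Rightarrow> ((nat \<Rightarrow> nat) \<Rightarrow> real) set set" where
  "E n d = divisor n d ` {G \<in> monic_forms n d.
     \<forall>x \<in> ({1..n} \<rightarrow>\<^sub>E UNIV) - {\<lambda>k\<in>{1..n}. 0}.
       card {t. form_eval n d G (x(0 := t)) = 0} = d}"

lemma finite_exps: "finite (exps n d)"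
proof (rule finite_subset)
  show "exps n d \<subseteq> {..n} \<rightarrow>\<^sub>E {..d}"
  proof
    fix i assume i: "i \<in> exps n d"
    have "i k \<le> d" if "k \<le> n" for k
      using i that member_le_sum[of k "{..n}" i] by (auto simp: exps_def)
    then show "i \<in> {..n} \<rightarrow>\<^sub>E {..d}"
      using i by (auto simp: exps_def PiE_iff)
  qed
  show "finite ({..n} \<rightarrow>\<^sub>E {..d})"
    by (intro finite_PiE) auto
qed

lemma card_exps: "card (exps n d) = (n + d) choose d"
proof -
  have "bij_betw (\<lambda>i. map i [0..<Suc n]) (exps n d) {l. length l = Suc n \<and> sum_list l = d}"
  proof (rule bij_betw_byWitness[where f' = "\<lambda>l. \<lambda>k\<in>{..n}. l ! k"])
    show "\<forall>i\<in>exps n d. (\<lambda>k\<in>{..n}. map i [0..<Suc n] ! k) = i"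
    proof
      fix i assume "i \<in> exps n d"
      then have "i \<in> extensional {..n}" by (auto simp: exps_def PiE_iff)
      then show "(\<lambda>k\<in>{..n}. map i [0..<Suc n] ! k) = i"
        by (intro extensionalityI[where A = "{..n}"]) (auto simp del: upt_Suc)
    qed
    show "\<forall>l\<in>{l. length l = Suc n \<and> sum_list l = d}.
        map (\<lambda>k\<in>{..n}. l ! k) [0..<Suc n] = l"
      by (auto intro!: nth_equalityI simp del: upt_Suc)
    show "(\<lambda>i. map i [0..<Suc n]) ` exps n d \<subseteq> {l. length l = Suc n \<and> sum_list l = d}"
      by (auto simp: exps_def sum_list_sum_nth atLeast0LessThan lessThan_Suc_atMost simp del: upt_Suc
          intro!: sum.cong)
    show "(\<lambda>l. \<lambda>k\<in>{..n}. l ! k) ` {l. length l = Suc n \<and> sum_list l = d} \<subseteq> exps n d"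
      by (auto simp: exps_def sum_list_sum_nth atLeast0LessThan lessThan_Suc_atMost
          split: if_splits)
  qed
  then have "card (exps n d) = card {l :: nat list. length l = Suc n \<and> sum_list l = d}"
    by (rule bij_betw_same_card)
  then show ?thesis
    by (simp add: card_length_sum_list add.commute)
qed

lemma istopology_Div:
  "istopology (\<lambda>U. U \<subseteq> Div n d \<and>
     openin (nonzero_forms n d) {c \<in> topspace (nonzero_forms n d). divisor n d c \<in> U})"
  unfolding istopology_def
proof (intro conjI allI impI)
  fix S T
  assume S: "S \<subseteq> Div n d \<and>
      openin (nonzero_forms n d) {c \<in> topspace (nonzero_forms n d). divisor n d c \<in> S}"
    and T: "T \<subseteq> Div n d \<and>
      openin (nonzero_forms n d) {c \<in> topspace (nonzero_forms n d). divisor n d c \<in> T}"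
  then show "S \<inter> T \<subseteq> Div n d" by blast
  have "{c \<in> topspace (nonzero_forms n d). divisor n d c \<in> S \<inter> T} =
      {c \<in> topspace (nonzero_forms n d). divisor n d c \<in> S} \<inter>
      {c \<in> topspace (nonzero_forms n d). divisor n d c \<in> T}" by blast
  then show "openin (nonzero_forms n d) {c \<in> topspace (nonzero_forms n d). divisor n d c \<in> S \<inter> T}"
    using S T by (simp add: openin_Int)
next
  fix K
  assume K: "\<forall>U\<in>K. U \<subseteq> Div n d \<and>
      openin (nonzero_forms n d) {c \<in> topspace (nonzero_forms n d). divisor n d c \<in> U}"
  then show "\<Union>K \<subseteq> Div n d" by blast
  have "{c \<in> topspace (nonzero_forms n d). divisor n d c \<in> \<Union>K} =
      (\<Union>U\<in>K. {c \<in> topspace (nonzero_forms n d). divisor n d c \<in> U})" by blast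
  then show "openin (nonzero_forms n d) {c \<in> topspace (nonzero_forms n d). divisor n d c \<in> \<Union>K}"
    using K by auto
qed

lemma openin_Div_topology:
  "openin (Div_topology n d) U \<longleftrightarrow> U \<subseteq> Div n d \<and>
     openin (nonzero_forms n d) {c \<in> topspace (nonzero_forms n d). divisor n d c \<in> U}"
  unfolding Div_topology_def topology_inverse'[OF istopology_Div] ..

lemma topspace_Div_topology: "topspace (Div_topology n d) = Div n d"
proof
  show "topspace (Div_topology n d) \<subseteq> Div n d"
    using openin_Div_topology openin_topspace by blast
  have "{c \<in> topspace (nonzero_forms n d). divisor n d c \<in> Div n d} = topspace (nonzero_forms n d)"
    by (auto simp: Div_def)
  then have "openin (Div_topology n d) (Div n d)"
    by (simp add: openin_Div_topology)
  then show "Div n d \<subseteq> topspace (Div_topology n d)"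
    by (rule openin_subset)
qed

lemma quotient_map_divisor: "quotient_map (nonzero_forms n d) (Div_topology n d) (divisor n d)"
  by (auto simp: quotient_map_def topspace_Div_topology openin_Div_topology Div_def)

lemma lead_exp_in_exps: "lead_exp n d \<in> exps n d"
  by (auto simp: lead_exp_def exps_def sum.delta)

lemma monic_forms_subset: "monic_forms n d \<subseteq> topspace (nonzero_forms n d)"
  using lead_exp_in_exps by (auto simp: monic_forms_def nonzero_forms_def)

lemma Div'_subset_Div: "Div' n d \<subseteq> Div n d"
  using monic_forms_subset by (auto simp: Div'_def Div_def)

end

theory Submission
  imports Defs "HOL-Computational_Algebra.Polynomial"
begin

text \<open>
  The condition defining \<open>E n d\<close> can be expressed by strict inequalities, to be verified only over
  a compact set. By the intermediate value theorem and the bound of the number of roots by the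
  degree, a real polynomial \<open>p \<noteq> 0\<close> of degree \<open>d\<close> has \<open>d\<close> distinct real roots iff there are
  \<open>q\<^sub>0 < \<dots> < q\<^sub>d\<close> with \<open>p(q\<^sub>j) p(q\<^sub>j\<^sub>+\<^sub>1) < 0\<close> for all \<open>j < d\<close> (lemma \<open>card_roots_eq_degree_iff\<close>);
  for the converse, the \<open>q\<^sub>j\<close> separate the roots. As a form is continuous jointly in its
  coefficients \<open>c\<close> and in its argument, the pairs \<open>(c, x)\<close> for which such \<open>q\<^sub>j\<close> exist form an open
  set (lemma \<open>openin_alternating\<close>).

  By homogeneity, replacing \<open>x = (x\<^sub>1, \<dots>, x\<^sub>n)\<close> by a positive multiple does not change the number of
  roots, so it is enough to consider \<open>x\<close> in the unit sphere. The sphere is compact, so projecting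
  away from it is a closed map, and the \<open>c\<close> that satisfy the condition for all \<open>x\<close> in the sphere
  form an open set. Intersected with the open set where the coefficient of \<open>x\<^sub>0\<^sup>d\<close> is nonzero,
  this is precisely the preimage of \<open>E n d\<close> under the quotient map \<open>divisor n d\<close>. Thus \<open>E n d\<close> is
  open even in the space of all divisors.
\<close>

section \<open>Real polynomials with as many roots as their degree\<close>

text \<open>If the number of roots equals the degree, then all the roots are simple, and points that
  separate them give alternating signs.\<close>

lemma card_roots_eq_degree_imp_alternating:
  fixes p :: "real poly"
  assumes p: "p \<noteq> 0" and card: "card {t. poly p t = 0} = degree p"
  shows "\<exists>q. \<forall>j<degree p. q j < q (Suc j) \<and> poly p (q j) * poly p (q (Suc j)) < 0"
proof -
  define R where "R = {t. poly p t = 0}"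
  define d where "d = degree p"
  have fin: "finite R" and cR: "card R = d"
    using p card by (auto simp: R_def d_def poly_roots_finite)
  define f where "f = (\<lambda>j. sorted_list_of_set R ! j)"
  have f_less: "f i < f j" if "i < j" "j < d" for i j
    using that fin cR strict_sorted_list_of_set[of R]
    by (auto simp: f_def sorted_wrt_iff_nth_less)
  have f_le: "f i \<le> f j" if "i \<le> j" "j < d" for i j
    using that f_less[of i j] by (cases "i = j") auto
  have f_img: "R = f ` {..<d}"
  proof -
    have "R = set (sorted_list_of_set R)" using fin by simp
    also have "\<dots> = f ` {..<d}"
      using fin cR by (auto simp: f_def set_conv_nth simp del: set_sorted_list_of_set)
    finally show ?thesis .
  qed
  define P where "P = (\<Prod>i<d. [:- f i, 1:])"
  have degP: "degree P = d"
    by (simp add: P_def degree_prod_eq_sum_degree)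
  have lcP: "lead_coeff P = 1"
    unfolding P_def lead_coeff_prod by simp
  have p_eq: "p = smult (lead_coeff p) P"
  proof (rule poly_eqI_degree_lead_coeff[where n = d and A = R])
    show "coeff p d = coeff (smult (lead_coeff p) P) d"
      using degP lcP by (simp add: d_def)
    show "poly p z = poly (smult (lead_coeff p) P) z" if z: "z \<in> R" for z
    proof -
      have "poly P z = 0" using z by (auto simp: f_img P_def poly_prod)
      then show ?thesis using z by (simp add: R_def)
    qed
  qed (use p cR degP in \<open>auto simp: d_def degree_smult_eq\<close>)
  define q where "q = (\<lambda>j. if j = 0 then f 0 - 1
      else if j < d then (f (j - 1) + f j) / 2 else f (d - 1) + 1)"
  have q_less: "q j < f i" if "j \<le> i" "i < d" for i j
  proof -
    have "q j < f j" using that f_less[of "j - 1" j] by (auto simp: q_def)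
    also have "f j \<le> f i" using that by (rule f_le)
    finally show ?thesis .
  qed
  have less_q: "f i < q j" if "i < j" "j \<le> d" for i j
  proof -
    have "f i \<le> f (j - 1)" using that by (intro f_le) auto
    also have "f (j - 1) < q j"
      using that f_less[of "j - 1" j] by (auto simp: q_def)
    finally show ?thesis .
  qed
  have "q j < q (Suc j) \<and> poly p (q j) * poly p (q (Suc j)) < 0" if j: "j < d" for j
  proof
    have a: "q j < f j" and b: "f j < q (Suc j)"
      using j q_less[of j j] less_q[of j "Suc j"] by auto
    then show "q j < q (Suc j)" by linarith
    \<comment> \<open>The root \<open>f j\<close> is the only one between \<open>q j\<close> and \<open>q (Suc j)\<close>, so all the other linear
      factors have the same sign at both points.\<close>
    define g where "g = (\<lambda>i. (q j - f i) * (q (Suc j) - f i))"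
    have pos: "(\<Prod>i\<in>{..<d} - {j}. g i) > 0"
    proof (rule prod_pos)
      fix i assume i: "i \<in> {..<d} - {j}"
      consider "i < j" | "Suc j \<le> i" using i by fastforce
      then show "0 < g i"
      proof cases
        case 1
        then show ?thesis using less_q[of i j] less_q[of i "Suc j"] j by (simp add: g_def)
      next
        case 2
        then show ?thesis using q_less[of j i] q_less[of "Suc j" i] i
          by (simp add: g_def mult_neg_neg)
      qed
    qed
    have "poly p (q j) * poly p (q (Suc j)) = (lead_coeff p)\<^sup>2 * (\<Prod>i<d. g i)"
      by (subst (1 2) p_eq) (simp add: P_def poly_prod g_def prod.distrib power2_eq_square)
    also have "(\<Prod>i<d. g i) = g j * (\<Prod>i\<in>{..<d} - {j}. g i)"
      using j by (intro prod.remove) auto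
    also have "g j < 0" using a b by (simp add: g_def mult_neg_pos)
    then have "(lead_coeff p)\<^sup>2 * (g j * (\<Prod>i\<in>{..<d} - {j}. g i)) < 0"
      using pos p by (simp add: mult_pos_neg mult_neg_pos)
    finally show "poly p (q j) * poly p (q (Suc j)) < 0" .
  qed
  then show ?thesis by (auto simp: d_def)
qed

lemma alternating_imp_card_roots_eq_degree:
  fixes p :: "real poly"
  assumes p: "p \<noteq> 0"
    and q: "\<And>j. j < degree p \<Longrightarrow> q j < q (Suc j) \<and> poly p (q j) * poly p (q (Suc j)) < 0"
  shows "card {t. poly p t = 0} = degree p"
proof (rule antisym)
  show "card {t. poly p t = 0} \<le> degree p"
    using p by (rule card_poly_roots_bound)
  have "\<exists>r. q j < r \<and> r < q (Suc j) \<and> poly p r = 0" if "j < degree p" for j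
    using poly_IVT[of "q j" "q (Suc j)" p] q[OF that] by blast
  then obtain r where
    r: "\<And>j. j < degree p \<Longrightarrow> q j < r j \<and> r j < q (Suc j) \<and> poly p (r j) = 0"
    by metis
  have q_mono: "q i \<le> q j" if "i \<le> j" "j < degree p" for i j
    using that
  proof (induction j rule: dec_induct)
    case (step m)
    then show ?case using q[of m] by auto
  qed simp
  have r_less: "r i < r j" if "i < j" "j < degree p" for i j
    using r[of i] r[of j] q_mono[of "Suc i" j] that by auto
  have "inj_on r {..<degree p}"
    by (rule inj_onI) (metis r_less lessThan_iff less_irrefl linorder_neqE_nat)
  then have "degree p = card (r ` {..<degree p})" by (simp add: card_image)
  also have "\<dots> \<le> card {t. poly p t = 0}"
    using r p by (intro card_mono poly_roots_finite) auto
  finally show "degree p \<le> card {t. poly p t = 0}" .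
qed

lemma card_roots_eq_degree_iff:
  fixes p :: "real poly"
  assumes "p \<noteq> 0"
  shows "card {t. poly p t = 0} = degree p \<longleftrightarrow>
    (\<exists>q. \<forall>j<degree p. q j < q (Suc j) \<and> poly p (q j) * poly p (q (Suc j)) < 0)"
  using card_roots_eq_degree_imp_alternating[OF assms]
    alternating_imp_card_roots_eq_degree[OF assms] by blast

section \<open>Forms as polynomials in the first variable\<close>

text \<open>The form with coefficients \<open>c\<close> as a polynomial in \<open>x\<^sub>0\<close>, for fixed values of the other
  variables. The value \<open>x 0\<close> is ignored.\<close>

definition dehomog :: "nat \<Rightarrow> nat \<Rightarrow> ((nat \<Rightarrow> nat) \<Rightarrow> real) \<Rightarrow> (nat \<Rightarrow> real) \<Rightarrow> real poly" where
  "dehomog n d c x = (\<Sum>i\<in>exps n d. monom (c i * (\<Prod>k=1..n. x k ^ i k)) (i 0))"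

lemma prod_atMost_shift:
  fixes g :: "nat \<Rightarrow> 'a :: comm_monoid_mult"
  shows "(\<Prod>k\<le>n. g k) = g 0 * (\<Prod>k=1..n. g k)"
  by (simp add: atMost_atLeast0 prod.atLeast_Suc_atMost)

lemma poly_dehomog: "poly (dehomog n d c x) t = form_eval n d c (x(0 := t))"
  unfolding dehomog_def form_eval_def poly_sum poly_monom prod_atMost_shift
  by (intro sum.cong refl) (simp add: mult_ac)

lemma exps_le: "i \<in> exps n d \<Longrightarrow> k \<le> n \<Longrightarrow> i k \<le> d"
  using member_le_sum[of k "{..n}" i] by (auto simp: exps_def)

lemma exps_eq_lead_exp:
  assumes i: "i \<in> exps n d" and "i 0 = d"
  shows "i = lead_exp n d"
proof (rule extensionalityI[where A = "{..n}"])
  have "(\<Sum>k\<le>n. i k) = i 0 + (\<Sum>k=1..n. i k)"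
    by (simp add: atMost_atLeast0 sum.atLeast_Suc_atMost)
  then have "(\<Sum>k=1..n. i k) = 0" using assms by (simp add: exps_def)
  then show "i k = lead_exp n d k" if "k \<in> {..n}" for k
    using that assms by (cases "k = 0") (auto simp: lead_exp_def)
qed (use i in \<open>auto simp: exps_def lead_exp_def PiE_iff\<close>)

lemma degree_dehomog_le: "degree (dehomog n d c x) \<le> d"
  unfolding dehomog_def
  by (intro degree_sum_le finite_exps) (meson degree_monom_le exps_le le0 le_trans)

lemma coeff_dehomog: "coeff (dehomog n d c x) d = c (lead_exp n d)"
proof -
  have "coeff (dehomog n d c x) d =
      (\<Sum>i\<in>exps n d. if i = lead_exp n d then c i * (\<Prod>k=1..n. x k ^ i k) else 0)"
    unfolding dehomog_def coeff_sum
    by (intro sum.cong refl) (auto simp: lead_exp_def dest: exps_eq_lead_exp)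
  also have "\<dots> = c (lead_exp n d) * (\<Prod>k=1..n. x k ^ lead_exp n d k)"
    by (simp add: finite_exps lead_exp_in_exps)
  also have "(\<Prod>k=1..n. x k ^ lead_exp n d k) = 1"
    by (intro prod.neutral) (auto simp: lead_exp_def)
  finally show ?thesis by simp
qed

text \<open>The sign condition that detects \<open>d\<close> distinct real roots:
  there are points \<open>q\<^sub>0 < \<dots> < q\<^sub>d\<close> for \<open>x\<^sub>0\<close> at which the values of the form alternate in sign.\<close>

definition alternating :: "nat \<Rightarrow> nat \<Rightarrow> ((nat \<Rightarrow> nat) \<Rightarrow> real) \<Rightarrow> (nat \<Rightarrow> real) \<Rightarrow> bool" where
  "alternating n d c x \<longleftrightarrow> (\<exists>q. \<forall>j<d. q j < q (Suc j) \<and>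
     form_eval n d c (x(0 := q j)) * form_eval n d c (x(0 := q (Suc j))) < 0)"

lemma card_form_roots_iff_alternating:
  assumes "c (lead_exp n d) \<noteq> 0"
  shows "card {t. form_eval n d c (x(0 := t)) = 0} = d \<longleftrightarrow> alternating n d c x"
proof -
  have nz: "dehomog n d c x \<noteq> 0" and deg: "degree (dehomog n d c x) = d"
    using assms coeff_dehomog[of n d c x] degree_dehomog_le[of n d c x]
    by (auto simp: le_degree order.antisym)
  show ?thesis
    using card_roots_eq_degree_iff[OF nz] by (simp add: deg poly_dehomog alternating_def)
qed

section \<open>Restriction to the unit sphere\<close>

lemma form_eval_scale:
  assumes "\<And>k. k \<le> n \<Longrightarrow> y k = s * x k"
  shows "form_eval n d c y = s ^ d * form_eval n d c x"
proof -
  have "(\<Prod>k\<le>n. y k ^ i k) = s ^ d * (\<Prod>k\<le>n. x k ^ i k)" if "i \<in> exps n d" for i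
  proof -
    have "(\<Prod>k\<le>n. y k ^ i k) = (\<Prod>k\<le>n. s ^ i k) * (\<Prod>k\<le>n. x k ^ i k)"
      using assms by (simp add: power_mult_distrib flip: prod.distrib)
    also have "(\<Prod>k\<le>n. s ^ i k) = s ^ d"
      using that by (simp add: exps_def flip: power_sum)
    finally show ?thesis .
  qed
  then show ?thesis
    unfolding form_eval_def sum_distrib_left by (intro sum.cong refl) simp
qed

lemma card_form_roots_scale:
  assumes s: "s \<noteq> 0" and y: "\<And>k. k \<in> {1..n} \<Longrightarrow> y k = s * x k"
  shows "card {t. form_eval n d c (y(0 := t)) = 0} = card {t. form_eval n d c (x(0 := t)) = 0}"
proof -
  have ev: "form_eval n d c (y(0 := s * t)) = s ^ d * form_eval n d c (x(0 := t))" for t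
    by (rule form_eval_scale) (use y in auto)
  have "bij_betw (\<lambda>t. s * t) {t. form_eval n d c (x(0 := t)) = 0}
      {t. form_eval n d c (y(0 := t)) = 0}"
  proof (rule bij_betw_byWitness[where f' = "\<lambda>t. t / s"])
    show "(\<lambda>t. t / s) ` {t. form_eval n d c (y(0 := t)) = 0} \<subseteq> {t. form_eval n d c (x(0 := t)) = 0}"
    proof clarify
      fix t assume "form_eval n d c (y(0 := t)) = 0"
      then show "form_eval n d c (x(0 := t / s)) = 0"
        using ev[of "t / s"] s by simp
    qed
  qed (use s ev in auto)
  then show ?thesis by (simp add: bij_betw_same_card)
qed

text \<open>The Euclidean unit sphere of the space of \<open>(x\<^sub>1, \<dots>, x\<^sub>n)\<close>; it is empty if \<open>n = 0\<close>.\<close>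

definition unit_sphere :: "nat \<Rightarrow> (nat \<Rightarrow> real) set" where
  "unit_sphere n = {x \<in> {1..n} \<rightarrow>\<^sub>E UNIV. (\<Sum>k=1..n. (x k)\<^sup>2) = 1}"

lemma unit_sphere_subset: "unit_sphere n \<subseteq> ({1..n} \<rightarrow>\<^sub>E UNIV) - {\<lambda>k\<in>{1..n}. 0}"
  by (auto simp: unit_sphere_def)

lemma all_nonzero_iff_all_unit_sphere:
  "(\<forall>x \<in> ({1..n} \<rightarrow>\<^sub>E UNIV) - {\<lambda>k\<in>{1..n}. 0}. card {t. form_eval n d c (x(0 := t)) = 0} = d) \<longleftrightarrow>
   (\<forall>x \<in> unit_sphere n. card {t. form_eval n d c (x(0 := t)) = 0} = d)"
proof (intro iffI ballI)
  fix x :: "nat \<Rightarrow> real"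
  assume R: "\<forall>x \<in> unit_sphere n. card {t. form_eval n d c (x(0 := t)) = 0} = d"
    and x: "x \<in> ({1..n} \<rightarrow>\<^sub>E UNIV) - {\<lambda>k\<in>{1..n}. 0}"
  define N where "N = (\<Sum>k=1..n. (x k)\<^sup>2)"
  have "N \<noteq> 0"
  proof
    assume "N = 0"
    then have "\<forall>k\<in>{1..n}. x k = 0" by (simp add: N_def sum_nonneg_eq_0_iff)
    then have "x = (\<lambda>k\<in>{1..n}. 0)"
      using x by (intro extensionalityI[where A = "{1..n}"]) (auto simp: PiE_iff)
    then show False using x by blast
  qed
  moreover have "N \<ge> 0" by (simp add: N_def sum_nonneg)
  ultimately have N: "N > 0" by simp
  define y where "y = (\<lambda>k\<in>{1..n}. x k / sqrt N)"
  have "(\<Sum>k=1..n. (y k)\<^sup>2) = N / N"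
    using N by (simp add: y_def N_def power_divide flip: sum_divide_distrib)
  then have "y \<in> unit_sphere n" using N by (simp add: unit_sphere_def y_def)
  then have "card {t. form_eval n d c (y(0 := t)) = 0} = d" using R by blast
  moreover have "card {t. form_eval n d c (y(0 := t)) = 0} =
      card {t. form_eval n d c (x(0 := t)) = 0}"
    by (rule card_form_roots_scale[where s = "1 / sqrt N"]) (use N in \<open>auto simp: y_def\<close>)
  ultimately show "card {t. form_eval n d c (x(0 := t)) = 0} = d" by simp
qed (use unit_sphere_subset in blast)

lemma compactin_unit_sphere: "compactin (powertop_real {1..n}) (unit_sphere n)"
proof (rule closed_compactin)
  show "compactin (powertop_real {1..n}) ({1..n} \<rightarrow>\<^sub>E {-1..1})"
    by (simp add: compactin_PiE)
  show "unit_sphere n \<subseteq> {1..n} \<rightarrow>\<^sub>E {-1..1}"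
  proof
    fix x assume x: "x \<in> unit_sphere n"
    have "x k \<in> {-1..1}" if "k \<in> {1..n}" for k
    proof -
      have "(x k)\<^sup>2 \<le> (\<Sum>k=1..n. (x k)\<^sup>2)" using that by (intro member_le_sum) auto
      then have "(x k)\<^sup>2 \<le> 1" using x by (simp add: unit_sphere_def)
      then show ?thesis by (simp add: abs_square_le_1 abs_le_iff)
    qed
    then show "x \<in> {1..n} \<rightarrow>\<^sub>E {-1..1}" using x by (auto simp: unit_sphere_def PiE_iff)
  qed
  have "continuous_map (powertop_real {1..n}) euclideanreal (\<lambda>x. \<Sum>k=1..n. (x k)\<^sup>2)"
    by (intro continuous_intros) auto
  from closedin_continuous_map_preimage[OF this, of "{1}"]
  show "closedin (powertop_real {1..n}) (unit_sphere n)"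
    by (simp add: unit_sphere_def)
qed

section \<open>Openness\<close>

lemma continuous_map_form_eval:
  "continuous_map (prod_topology (powertop_real (exps n d)) (powertop_real {1..n})) euclideanreal
     (\<lambda>z. form_eval n d (fst z) ((snd z)(0 := t)))"
  unfolding form_eval_def
proof (intro continuous_map_sum continuous_map_real_mult continuous_map_prod
    continuous_map_real_pow finite_exps)
  fix k assume "k \<in> {..n}"
  then show "continuous_map (prod_topology (powertop_real (exps n d)) (powertop_real {1..n}))
      euclideanreal (\<lambda>z. ((snd z)(0 := t)) k)"
    by (cases "k = 0") (auto intro: continuous_map_prod_snd)
qed (auto intro: continuous_map_prod_fst)

lemma openin_alternating:
  fixes n d
  defines "Z \<equiv> prod_topology (powertop_real (exps n d)) (powertop_real {1..n})"
  shows "openin Z {z \<in> topspace Z. alternating n d (fst z) (snd z)}"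
proof -
  define F where "F = (\<lambda>z t. form_eval n d (fst z) ((snd z)(0 := t)))"
  define U where "U = (\<lambda>q j. {z \<in> topspace Z. F z (q j) * F z (q (Suc j)) \<in> {..<0}})"
  have "openin Z (U q j)" for q j
    unfolding U_def F_def Z_def
    by (intro openin_continuous_map_preimage[where Y = euclideanreal] continuous_map_real_mult
        continuous_map_form_eval) simp
  then have "openin Z ((\<Inter>j\<in>{..<d}. U q j) \<inter> topspace Z)" for q
    by (intro openin_INT) auto
  then have "openin Z (\<Union>q\<in>{q. \<forall>j<d. q j < q (Suc j)}. (\<Inter>j\<in>{..<d}. U q j) \<inter> topspace Z)"
    by blast
  also have "(\<Union>q\<in>{q. \<forall>j<d. q j < q (Suc j)}. (\<Inter>j\<in>{..<d}. U q j) \<inter> topspace Z) =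
      {z \<in> topspace Z. alternating n d (fst z) (snd z)}"
    by (auto simp: U_def F_def alternating_def)
  finally show ?thesis .
qed

text \<open>The tube lemma, phrased for the sections of an open set over a compact set.\<close>

lemma openin_all_compactin:
  assumes K: "compactin Y K" and W: "openin (prod_topology X Y) W"
  shows "openin X {x \<in> topspace X. \<forall>y\<in>K. (x, y) \<in> W}"
proof -
  let ?Y = "subtopology Y K"
  have KY: "topspace ?Y = K" using compactin_subset_topspace[OF K] by auto
  have "closed_map (prod_topology X ?Y) X fst"
    using K by (intro Abstract_Topological_Spaces.closed_map_fst) (rule compact_space_subtopology)
  moreover have "openin (prod_topology X ?Y) (W \<inter> (topspace X \<times> K))"
    using W by (simp add: prod_topology_subtopology(2) openin_subtopology_Int)
  then have "closedin (prod_topology X ?Y) (topspace (prod_topology X ?Y) - W \<inter> (topspace X \<times> K))"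
    by blast
  ultimately have "closedin X (fst ` (topspace (prod_topology X ?Y) - W \<inter> (topspace X \<times> K)))"
    by (auto simp: closed_map_def)
  moreover have "{x \<in> topspace X. \<forall>y\<in>K. (x, y) \<in> W} =
      topspace X - fst ` (topspace (prod_topology X ?Y) - W \<inter> (topspace X \<times> K))"
    using KY by (force simp: image_iff)
  ultimately show ?thesis by (metis openin_diff openin_topspace)
qed

lemma form_eval_restrict_mult:
  "form_eval n d (\<lambda>i\<in>exps n d. r * c i) x = r * form_eval n d c x"
  unfolding form_eval_def sum_distrib_left by (intro sum.cong) auto

text \<open>The preimage of \<open>E n d\<close> in terms of arbitrary representatives: a form \<open>c\<close> has a monic multiple
  iff its leading coefficient is nonzero, and nonzero multiples have the same roots.\<close>

lemma divisor_in_E_iff: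
  assumes c: "c \<in> exps n d \<rightarrow>\<^sub>E UNIV"
  shows "divisor n d c \<in> E n d \<longleftrightarrow>
    c (lead_exp n d) \<noteq> 0 \<and> (\<forall>x \<in> unit_sphere n. alternating n d c x)"
proof -
  let ?real_rooted = "\<lambda>c. \<forall>x \<in> ({1..n} \<rightarrow>\<^sub>E UNIV) - {\<lambda>k\<in>{1..n}. 0}.
      card {t. form_eval n d c (x(0 := t)) = 0} = d"
  have c_rep: "(\<lambda>i\<in>exps n d. c i) = c"
    using c by simp
  have "divisor n d c \<in> E n d \<longleftrightarrow> c (lead_exp n d) \<noteq> 0 \<and> ?real_rooted c"
  proof
    assume "divisor n d c \<in> E n d"
    then obtain G where G: "G \<in> monic_forms n d" "?real_rooted G"
      and eq: "divisor n d c = divisor n d G"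
      by (auto simp: E_def)
    have "c \<in> divisor n d c"
      unfolding divisor_def by (auto intro!: exI[of _ 1] simp: c_rep)
    then obtain r where r: "r \<noteq> 0" and cG: "c = (\<lambda>i\<in>exps n d. r * G i)"
      unfolding eq by (auto simp: divisor_def)
    have "c (lead_exp n d) = r"
      using G lead_exp_in_exps by (simp add: cG monic_forms_def)
    moreover have "?real_rooted c"
      using G(2) r by (simp add: cG form_eval_restrict_mult)
    ultimately show "c (lead_exp n d) \<noteq> 0 \<and> ?real_rooted c" using r by simp
  next
    assume R: "c (lead_exp n d) \<noteq> 0 \<and> ?real_rooted c"
    define s where "s = 1 / c (lead_exp n d)"
    have s: "s \<noteq> 0" using R by (simp add: s_def)
    define G where "G = (\<lambda>i\<in>exps n d. s * c i)"
    have "G \<in> monic_forms n d"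
      using R lead_exp_in_exps by (simp add: monic_forms_def G_def s_def)
    moreover have "?real_rooted G"
      using R s by (simp add: G_def form_eval_restrict_mult)
    moreover have "divisor n d c = divisor n d G"
    proof -
      have "{(\<lambda>i\<in>exps n d. r * G i) | r. r \<noteq> 0} =
          (\<lambda>r. \<lambda>i\<in>exps n d. r * c i) ` (\<lambda>r. r * s) ` {r. r \<noteq> 0}"
        by (auto simp: G_def image_image mult.assoc cong: restrict_cong)
      also have "(\<lambda>r. r * s) ` {r. r \<noteq> 0} = {r. r \<noteq> 0}"
      proof -
        have "r = r / s * s" for r using s by simp
        then show ?thesis using s by (auto intro!: image_eqI[where x = "_ / s"])
      qed
      finally show ?thesis unfolding divisor_def by (simp only: image_Collect mem_Collect_eq)
    qed
    ultimately show "divisor n d c \<in> E n d" unfolding E_def by blast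
  qed
  then show ?thesis
    unfolding all_nonzero_iff_all_unit_sphere
    using card_form_roots_iff_alternating by blast
qed

theorem lemma6p2:
  fixes n d :: nat
  assumes "n \<ge> 1"
  shows "openin (subtopology (Div_topology n d) (Div' n d)) (E n d)"
proof -
  let ?X = "powertop_real (exps n d)" and ?Y = "powertop_real {1..n}"
  define A where "A = {c \<in> topspace ?X. c (lead_exp n d) \<in> - {0}}"
  define B where "B = {c \<in> topspace ?X. \<forall>x\<in>unit_sphere n.
      (c, x) \<in> {z \<in> topspace (prod_topology ?X ?Y). alternating n d (fst z) (snd z)}}"
  have "openin ?X A"
    unfolding A_def
    by (rule openin_continuous_map_preimage[where Y = euclideanreal])
      (auto intro: continuous_map_product_projection lead_exp_in_exps)
  moreover have "openin ?X B"
    unfolding B_def by (rule openin_all_compactin[OF compactin_unit_sphere openin_alternating])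
  ultimately have "openin ?X (A \<inter> B)" by (rule openin_Int)
  moreover have "topspace (nonzero_forms n d) = (exps n d \<rightarrow>\<^sub>E UNIV) - {\<lambda>i\<in>exps n d. 0}"
    by (auto simp: nonzero_forms_def)
  ultimately have "openin (nonzero_forms n d) (topspace (nonzero_forms n d) \<inter> (A \<inter> B))"
    unfolding nonzero_forms_def by (metis openin_subtopology_Int2)
  also have "topspace (nonzero_forms n d) \<inter> (A \<inter> B) =
      {c \<in> topspace (nonzero_forms n d). divisor n d c \<in> E n d}"
  proof -
    have "c \<in> A \<inter> B \<longleftrightarrow> divisor n d c \<in> E n d" if "c \<in> topspace (nonzero_forms n d)" for c
    proof -
      have c: "c \<in> exps n d \<rightarrow>\<^sub>E UNIV" using that by (simp add: nonzero_forms_def)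
      have "x \<in> {1..n} \<rightarrow>\<^sub>E UNIV" if "x \<in> unit_sphere n" for x
        using that by (simp add: unit_sphere_def)
      then show ?thesis
        using c by (simp add: A_def B_def divisor_in_E_iff)
    qed
    then show ?thesis by blast
  qed
  finally have pre: "openin (nonzero_forms n d)
      {c \<in> topspace (nonzero_forms n d). divisor n d c \<in> E n d}" .
  have sub: "E n d \<subseteq> Div' n d" by (auto simp: E_def Div'_def)
  then have "openin (Div_topology n d) (E n d)"
    using pre Div'_subset_Div by (auto simp: openin_Div_topology)
  then show ?thesis
    using sub by (metis inf.absorb2 openin_subtopology_Int2)
qed

end
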